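(* The free group $\mathbb{F}_2$ on two generators is PA'-recognizable. Every finite group is PA'-recognizable.
   Context: PA'-recognizability: let $\mathcal F=\{f_i:B_i\to B_i',\ i=1,\dots,k\}$ be a finite set of piecewise affine rational homeomorphisms, where each $B_i$ and $B_i'$ is a finite union of bounded (closed) rational polytopes of $\mathbb{R}^n$ (for a common $n$); that is, each $f_i$ is a homeomorphism and $B_i$ is a finite union of bounded rational polytopes on each of which $f_i$ is of the form $x\mapsto Mx+b$ with $M,b$ having rational entries. Let $S_{\mathcal F}$ be the closure of $\{f_i,f_i^{-1}\}$ under composition of partial functions (elements of $S_{\mathcal F}$ are partial maps, defined wherever the composition makes sense, possibly with empty domain). Let $T_{\mathcal F}$ be the common domain (the intersection of the domains) of all functions in $S_{\mathcal F}$. The group generated by $\mathcal F$ is $G_{\mathcal F}=\{f_{|T_{\mathcal F}}: f\in S_{\mathcal F}\}$, a group of bijections of $T_{\mathcal F}$ under composition. A finitely generated group $G$ is PA'-recognizable if there is such a finite set $\mathcal F$ with: (A) $G$ is isomorphic to $G_{\mathcal F}$; (B) for every $t\in T_{\mathcal F}$ and $g\in G_{\mathcal F}$, if $g(f(t))=f(t)$ for all $f\in G_{\mathcal F}$, then $g$ is the identity. *)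

theory Defs
  imports "HOL-Analysis.Analysis" "HOL-Algebra.Generated_Groups"
begin

section \<open>Rational polytopes and piecewise affine rational homeomorphisms\<close>

text \<open>
  The dimension \<open>n\<close> is existentially quantified in the notion of PA'-recognizability, so
  \<open>\<real>\<^sup>n\<close> is the library's \<open>Euclidean_space n\<close>: the functions \<open>nat \<Rightarrow> real\<close> that vanish from
  index \<open>n\<close> on.
\<close>

text \<open>
  A pair \<open>(a, c) \<in> H\<close> stands for the closed half-space of all \<open>x\<close> with \<open>a \<bullet> x \<le> c\<close>; only the
  coefficients \<open>a i\<close> with \<open>i < n\<close> matter.
\<close>

definition bounded_rational_polytope :: "nat \<Rightarrow> (nat \<Rightarrow> real) set \<Rightarrow> bool" where
  "bounded_rational_polytope n P \<longleftrightarrow>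
     (\<exists>H :: ((nat \<Rightarrow> real) \<times> real) set.
        finite H \<and>
        (\<forall>(a, c) \<in> H. (\<forall>i<n. a i \<in> \<rat>) \<and> c \<in> \<rat>) \<and>
        P = {x \<in> topspace (Euclidean_space n). \<forall>(a, c) \<in> H. (\<Sum>i<n. a i * x i) \<le> c}) \<and>
     (\<exists>R. \<forall>x\<in>P. \<forall>i<n. \<bar>x i\<bar> \<le> R)"

definition rational_polytope_union :: "nat \<Rightarrow> (nat \<Rightarrow> real) set \<Rightarrow> bool" where
  "rational_polytope_union n B \<longleftrightarrow>
     (\<exists>\<P>. finite \<P> \<and> (\<forall>P\<in>\<P>. bounded_rational_polytope n P) \<and> B = \<Union>\<P>)"

definition affine_rational_on ::
    "nat \<Rightarrow> (nat \<Rightarrow> real) set \<Rightarrow> ((nat \<Rightarrow> real) \<rightharpoonup> (nat \<Rightarrow> real)) \<Rightarrow> bool" where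
  "affine_rational_on n P f \<longleftrightarrow>
     (\<exists>(M :: nat \<Rightarrow> nat \<Rightarrow> real) (b :: nat \<Rightarrow> real).
        (\<forall>i<n. \<forall>j<n. M i j \<in> \<rat>) \<and> (\<forall>i<n. b i \<in> \<rat>) \<and>
        (\<forall>x\<in>P. f x = Some (\<lambda>i. if i < n then (\<Sum>j<n. M i j * x j) + b i else 0)))"

text \<open>
  A map \<open>f : B \<rightarrow> B'\<close> is represented by a partial function with \<open>dom f = B\<close> and \<open>ran f = B'\<close>.
\<close>

definition pa_rational_homeo ::
    "nat \<Rightarrow> ((nat \<Rightarrow> real) \<rightharpoonup> (nat \<Rightarrow> real)) \<Rightarrow> bool" where
  "pa_rational_homeo n f \<longleftrightarrow>
     rational_polytope_union n (ran f) \<and>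
     homeomorphic_map (subtopology (Euclidean_space n) (dom f))
       (subtopology (Euclidean_space n) (ran f)) (\<lambda>x. the (f x)) \<and>
     (\<exists>\<P>. finite \<P> \<and> dom f = \<Union>\<P> \<and>
        (\<forall>P\<in>\<P>. bounded_rational_polytope n P \<and> affine_rational_on n P f))"


section \<open>The group generated by a set of partial bijections\<close>

text \<open>Meaningful only for partial functions that are injective on their domain.\<close>

definition pinv :: "('a \<rightharpoonup> 'b) \<Rightarrow> ('b \<rightharpoonup> 'a)" where
  "pinv f = (\<lambda>y. if y \<in> ran f then Some (THE x. f x = Some y) else None)"

inductive_set partial_closure :: "('a \<rightharpoonup> 'a) set \<Rightarrow> ('a \<rightharpoonup> 'a) set"
  for F :: "('a \<rightharpoonup> 'a) set" where
  gen: "f \<in> F \<Longrightarrow> f \<in> partial_closure F"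
| inv: "f \<in> F \<Longrightarrow> pinv f \<in> partial_closure F"
| comp: "f \<in> partial_closure F \<Longrightarrow> g \<in> partial_closure F \<Longrightarrow> f \<circ>\<^sub>m g \<in> partial_closure F"

definition common_dom :: "('a \<rightharpoonup> 'a) set \<Rightarrow> 'a set" where
  "common_dom F = (\<Inter>f \<in> partial_closure F. dom f)"

text \<open>
  Elements are the restrictions \<open>f |` T\<close>; the unit \<open>Some |` T\<close> is the identity map of \<open>T\<close>.
  For \<open>F = {}\<close> the carrier is empty, so that degenerate case never yields a group.
\<close>

definition generated_group :: "('a \<rightharpoonup> 'a) set \<Rightarrow> ('a \<rightharpoonup> 'a) monoid" where
  "generated_group F =
     \<lparr>carrier = {f |` common_dom F | f. f \<in> partial_closure F},
      mult = (\<lambda>f g. f \<circ>\<^sub>m g),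
      one = Some |` common_dom F\<rparr>"


section \<open>PA'-recognizability\<close>

definition finitely_generated_group :: "('a, 'b) monoid_scheme \<Rightarrow> bool" where
  "finitely_generated_group G \<longleftrightarrow>
     group G \<and> (\<exists>S. finite S \<and> S \<subseteq> carrier G \<and> generate G S = carrier G)"

text \<open>
  In condition (B), \<open>g (f t) = f t\<close> is written as \<open>(g \<circ>\<^sub>m f) t = f t\<close>; both sides are defined
  because \<open>f\<close> and \<open>g\<close> are bijections of \<open>common_dom F\<close>.
\<close>

definition PA'_recognizable :: "('a, 'b) monoid_scheme \<Rightarrow> bool" where
  "PA'_recognizable G \<longleftrightarrow>
     finitely_generated_group G \<and>
     (\<exists>n\<ge>1. \<exists>F. finite F \<and> (\<forall>f\<in>F. pa_rational_homeo n f) \<and>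
        G \<cong> generated_group F \<and>
        (\<forall>t \<in> common_dom F. \<forall>g \<in> carrier (generated_group F).
           (\<forall>f \<in> carrier (generated_group F). (g \<circ>\<^sub>m f) t = f t) \<longrightarrow>
           g = \<one>\<^bsub>generated_group F\<^esub>))"


section \<open>Free groups\<close>

text \<open>
  The letter \<open>(x, True)\<close> stands for the generator \<open>x\<close>, and \<open>(x, False)\<close> for its inverse.
  The free group consists of the reduced words.
\<close>

definition letter_inv :: "'a \<times> bool \<Rightarrow> 'a \<times> bool" where
  "letter_inv l = (fst l, \<not> snd l)"

definition reduced :: "('a \<times> bool) list \<Rightarrow> bool" where
  "reduced w \<longleftrightarrow> successively (\<lambda>k l. l \<noteq> letter_inv k) w"

fun cons_cancel :: "'a \<times> bool \<Rightarrow> ('a \<times> bool) list \<Rightarrow> ('a \<times> bool) list" where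
  "cons_cancel l [] = [l]"
| "cons_cancel l (k # w) = (if k = letter_inv l then w else l # k # w)"

definition free_group :: "'a set \<Rightarrow> ('a \<times> bool) list monoid" where
  "free_group X =
     \<lparr>carrier = {w \<in> lists (X \<times> UNIV). reduced w},
      mult = (\<lambda>v w. foldr cons_cancel v w),
      one = []\<rparr>"

end

theory Submission
  imports Defs
begin

text \<open>
  Both parts realise the group by an action on a subset of the line, with \<open>n = 1\<close>.

  A finite group is realised by its left regular action on a copy of itself inside \<open>\<nat>\<close>: points are
  rational polytopes, every map between finite sets of points is piecewise affine, all the maps
  have the same domain, and the action is free.

  For the free group on two generators, each of the four letters \<open>l\<close> gets a contraction of the unit
  interval onto a small interval \<open>cell l\<close>, the four cells being disjoint. The letter \<open>l\<close> acts by its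
  contraction on the cells other than that of \<open>l\<^sup>-\<^sup>1\<close>, and by undoing the contraction of \<open>l\<^sup>-\<^sup>1\<close>
  on the part of the cell of \<open>l\<^sup>-\<^sup>1\<close> where this lands in a cell other than that of \<open>l\<close>: on a point
  whose address is a reduced word, this is left multiplication with cancellation. These maps are
  defined on finitely many closed intervals with rational endpoints, so they are homeomorphisms of
  the required kind, and the map of \<open>l\<^sup>-\<^sup>1\<close> inverts that of \<open>l\<close>. Their common domain is contained in
  the union of the cells. Ping-pong on it needs only this: a nonempty reduced word \<open>w\<close> moves a point
  from \<open>cell m\<close> into the cell of its first letter unless \<open>m\<close> is inverse to its last letter. From any
  point, one letter \<open>m\<close> suffices to reach a cell from which \<open>w\<close> moves the point to another cell: \<open>m\<close>
  has to avoid three letters, and there are four. So \<open>w\<close> acts nontrivially on every orbit.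

  Faithfulness on every orbit gives condition (B). It gives the isomorphism as well, once the common
  domain is known to be nonempty, as \<open>PA'_recognizable_if_action\<close> shows. For the free group this is
  witnessed by the points with address \<open>w z z z \<dots>\<close> for one fixed letter \<open>z\<close>.
\<close>

section \<open>From actions to generated groups\<close>

lemma pinv_eqI:
  assumes "\<And>x y. f x = Some y \<longleftrightarrow> g y = Some x"
  shows "pinv f = g"
proof
  fix y
  show "pinv f y = g y"
  proof (cases "g y")
    case None
    then have "y \<notin> ran f" using assms by (auto simp: ran_def)
    then show ?thesis using None by (simp add: pinv_def)
  next
    case (Some x)
    then have "y \<in> ran f" using assms by (auto simp: ran_def)
    moreover have "(THE x. f x = Some y) = x" using assms Some by auto
    ultimately show ?thesis using Some by (simp add: pinv_def)
  qed
qed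

text \<open>
  The common domain is invariant: if \<open>p\<close> sends \<open>t\<close> to \<open>u\<close>, then every \<open>q\<close> is defined at \<open>u\<close> because
  the composite of \<open>q\<close> and \<open>p\<close> is defined at \<open>t\<close>.
\<close>
lemma partial_closure_common_dom:
  assumes p: "p \<in> partial_closure F" and t: "t \<in> common_dom F"
  obtains u where "u \<in> common_dom F" "p t = Some u"
proof -
  from assms obtain u where u: "p t = Some u" by (auto simp: common_dom_def)
  have "u \<in> dom q" if "q \<in> partial_closure F" for q
  proof -
    have "q \<circ>\<^sub>m p \<in> partial_closure F" using that p by (rule partial_closure.comp)
    then have "t \<in> dom (q \<circ>\<^sub>m p)" using t by (auto simp: common_dom_def)
    then show ?thesis using u by (auto simp: map_comp_def)
  qed
  then show ?thesis using u that by (auto simp: common_dom_def)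
qed

lemma invariant_subset_common_dom:
  assumes gen: "\<And>f t. f \<in> F \<Longrightarrow> t \<in> L \<Longrightarrow> \<exists>u\<in>L. f t = Some u"
    and inv: "\<And>f t. f \<in> F \<Longrightarrow> t \<in> L \<Longrightarrow> \<exists>u\<in>L. pinv f t = Some u"
  shows "L \<subseteq> common_dom F"
proof -
  have "\<forall>t\<in>L. \<exists>u\<in>L. p t = Some u" if "p \<in> partial_closure F" for p
    using that
  proof induction
    case (comp p q)
    then show ?case by (fastforce simp: map_comp_def)
  qed (use gen inv in blast)+
  then show ?thesis by (fastforce simp: common_dom_def)
qed

text \<open>
  The action \<open>\<alpha>\<close> extends the generators \<open>f s\<close> to all of \<open>G\<close>, so that on the common domain the partial
  closure consists of exactly the maps \<open>\<alpha> g\<close>, and \<open>g\<close> corresponds to \<open>\<alpha> g\<close>. The invariant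
  set \<open>L\<close> provides a point of the common domain; faithfulness on the orbit of this one point makes
  the correspondence injective, while faithfulness on all orbits is condition (B).
\<close>
lemma PA'_recognizable_if_action:
  fixes G :: "('a, 'b) monoid_scheme" (structure)
    and f :: "'a \<Rightarrow> (nat \<Rightarrow> real) \<rightharpoonup> (nat \<Rightarrow> real)"
    and \<alpha> :: "'a \<Rightarrow> (nat \<Rightarrow> real) \<Rightarrow> (nat \<Rightarrow> real)"
  assumes G: "group G"
    and S: "finite S" "S \<noteq> {}" "S \<subseteq> carrier G" "generate G S = carrier G"
    and S_inv: "\<And>s. s \<in> S \<Longrightarrow> inv s \<in> S"
    and n: "n \<ge> 1"
    and homeo: "\<And>s. s \<in> S \<Longrightarrow> pa_rational_homeo n (f s)"
    and pinv: "\<And>s. s \<in> S \<Longrightarrow> pinv (f s) = f (inv s)"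
    and inhabited: "L \<noteq> {}" "\<And>s t. s \<in> S \<Longrightarrow> t \<in> L \<Longrightarrow> \<exists>u\<in>L. f s t = Some u"
    and one: "\<And>t. t \<in> common_dom (f ` S) \<Longrightarrow> \<alpha> \<one> t = t"
    and mult: "\<And>g h t. g \<in> carrier G \<Longrightarrow> h \<in> carrier G \<Longrightarrow> t \<in> common_dom (f ` S) \<Longrightarrow>
      \<alpha> (g \<otimes> h) t = \<alpha> g (\<alpha> h t)"
    and gens: "\<And>s t. s \<in> S \<Longrightarrow> t \<in> common_dom (f ` S) \<Longrightarrow> f s t = Some (\<alpha> s t)"
    and faithful: "\<And>g t. g \<in> carrier G \<Longrightarrow> g \<noteq> \<one> \<Longrightarrow> t \<in> common_dom (f ` S) \<Longrightarrow>
      \<exists>h\<in>carrier G. \<alpha> g (\<alpha> h t) \<noteq> \<alpha> h t"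
  shows "PA'_recognizable G"
proof -
  interpret group G by (rule G)
  define F where "F = f ` S"
  define T where "T = common_dom F"
  define \<Phi> where "\<Phi> g = (\<lambda>t. Some (\<alpha> g t)) |` T" for g
  note facts = one[folded F_def T_def] mult[folded F_def T_def] gens[folded F_def T_def]
    faithful[folded F_def T_def]
  have closed: "u \<in> T" if "p \<in> partial_closure F" "t \<in> T" "p t = Some u" for p t u
    using that partial_closure_common_dom unfolding T_def by (metis option.inject)
  have "L \<subseteq> T" unfolding T_def
    by (rule invariant_subset_common_dom) (use inhabited pinv S_inv in \<open>auto simp: F_def\<close>)
  then obtain t0 where t0: "t0 \<in> T" using inhabited by auto
  have compose: "(p \<circ>\<^sub>m q) t = Some (\<alpha> (g \<otimes> h) t)"
    if "q \<in> partial_closure F" "g \<in> carrier G" "h \<in> carrier G"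
      "\<forall>t\<in>T. p t = Some (\<alpha> g t)" "\<forall>t\<in>T. q t = Some (\<alpha> h t)" "t \<in> T" for p q g h t
  proof -
    have "\<alpha> h t \<in> T" using closed[of q t] that by blast
    then show ?thesis using that facts(2)[of g h t] by (simp add: map_comp_def)
  qed
  have elem: "\<exists>g\<in>carrier G. \<forall>t\<in>T. p t = Some (\<alpha> g t)" if "p \<in> partial_closure F" for p
    using that
  proof induction
    case (gen p)
    then show ?case using facts(3) S by (auto simp: F_def)
  next
    case (inv p)
    then obtain s where s: "s \<in> S" "p = f s" by (auto simp: F_def)
    then have "\<forall>t\<in>T. pinv p t = Some (\<alpha> (inv s) t)" using pinv S_inv facts(3) by auto
    then show ?case using S S_inv s by blast
  next
    case (comp p q)
    then obtain g h where gh: "g \<in> carrier G" "\<forall>t\<in>T. p t = Some (\<alpha> g t)"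
      "h \<in> carrier G" "\<forall>t\<in>T. q t = Some (\<alpha> h t)" by blast
    then have "\<forall>t\<in>T. (p \<circ>\<^sub>m q) t = Some (\<alpha> (g \<otimes> h) t)"
      using compose comp.hyps by blast
    then show ?case using gh by blast
  qed
  have realised: "\<exists>p\<in>partial_closure F. \<forall>t\<in>T. p t = Some (\<alpha> g t)" if "g \<in> carrier G" for g
    using that unfolding S(4)[symmetric]
  proof induction
    case one
    obtain s where s: "s \<in> S" using S by auto
    have c: "f s \<in> partial_closure F" "f (inv s) \<in> partial_closure F"
      using s S_inv by (auto simp: F_def intro: partial_closure.gen)
    have "\<forall>t\<in>T. (f (inv s) \<circ>\<^sub>m f s) t = Some (\<alpha> (inv s \<otimes> s) t)"
      using compose[OF c(1), of "inv s" s "f (inv s)"] facts(3) s S S_inv by blast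
    moreover have "inv s \<otimes> s = \<one>" using s S by (intro l_inv) blast
    ultimately have "\<forall>t\<in>T. (f (inv s) \<circ>\<^sub>m f s) t = Some (\<alpha> \<one> t)" by simp
    then show ?case using partial_closure.comp c by blast
  next
    case (incl s)
    then show ?case using facts(3) by (auto simp: F_def intro!: partial_closure.gen bexI[of _ "f s"])
  next
    case (inv s)
    then show ?case using facts(3) S_inv
      by (auto simp: F_def intro!: partial_closure.gen bexI[of _ "f (inv s)"])
  next
    case (eng g h)
    then obtain p q where pq: "p \<in> partial_closure F" "\<forall>t\<in>T. p t = Some (\<alpha> g t)"
      "q \<in> partial_closure F" "\<forall>t\<in>T. q t = Some (\<alpha> h t)" by blast
    have "\<forall>t\<in>T. (p \<circ>\<^sub>m q) t = Some (\<alpha> (g \<otimes> h) t)"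
      using compose[OF pq(3)] pq eng.hyps S(4) by blast
    then show ?case using pq partial_closure.comp by blast
  qed
  have maps: "\<alpha> g t \<in> T" if "g \<in> carrier G" "t \<in> T" for g t
    using realised[OF that(1)] that(2) closed by blast
  have \<Phi>_eq: "p |` T = \<Phi> g" if "\<forall>t\<in>T. p t = Some (\<alpha> g t)" for p g
    using that by (auto simp: \<Phi>_def restrict_map_def)
  have carrier: "carrier (generated_group F) = \<Phi> ` carrier G"
  proof
    show "carrier (generated_group F) \<subseteq> \<Phi> ` carrier G"
      unfolding generated_group_def using elem \<Phi>_eq by (fastforce simp: T_def[symmetric])
    show "\<Phi> ` carrier G \<subseteq> carrier (generated_group F)"
    proof
      fix \<phi> assume "\<phi> \<in> \<Phi> ` carrier G"
      then obtain g where g: "g \<in> carrier G" "\<phi> = \<Phi> g" by blast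
      obtain p where "p \<in> partial_closure F" "\<forall>t\<in>T. p t = Some (\<alpha> g t)"
        using realised g by blast
      then show "\<phi> \<in> carrier (generated_group F)"
        using \<Phi>_eq g by (force simp: generated_group_def T_def[symmetric])
    qed
  qed
  have \<Phi>_mult: "\<Phi> (g \<otimes> h) = \<Phi> g \<circ>\<^sub>m \<Phi> h" if "g \<in> carrier G" "h \<in> carrier G" for g h
    using that maps facts(2) by (auto simp: \<Phi>_def restrict_map_def map_comp_def fun_eq_iff)
  have \<Phi>_one: "\<Phi> \<one> = \<one>\<^bsub>generated_group F\<^esub>"
    using facts(1) by (auto simp: \<Phi>_def restrict_map_def generated_group_def T_def[symmetric] fun_eq_iff)
  have separates: "g = \<one>" if "g \<in> carrier G" "t \<in> T" "\<forall>h\<in>carrier G. \<alpha> g (\<alpha> h t) = \<alpha> h t" for g t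
    using that facts(4) by blast
  have inj: "inj_on \<Phi> (carrier G)"
  proof (rule inj_onI)
    fix g h assume gh: "g \<in> carrier G" "h \<in> carrier G" "\<Phi> g = \<Phi> h"
    have eq: "\<alpha> g t = \<alpha> h t" if "t \<in> T" for t
      using fun_cong[OF gh(3), of t] that by (simp add: \<Phi>_def)
    have "\<alpha> (inv h \<otimes> g) t = t" if t: "t \<in> T" for t
    proof -
      have "\<alpha> (inv h \<otimes> g) t = \<alpha> (inv h \<otimes> h) t"
        using gh t eq facts(2)[of "inv h" g t] facts(2)[of "inv h" h t] by (simp del: l_inv)
      then show ?thesis using gh t facts(1) by simp
    qed
    then have "inv h \<otimes> g = \<one>" using gh maps t0 by (intro separates[of _ t0]) auto
    then show "g = h" using gh by (metis inv_equality inv_inv inv_closed)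
  qed
  have iso: "\<Phi> \<in> iso G (generated_group F)"
    unfolding iso_def hom_def using carrier inj \<Phi>_mult
    by (auto simp: bij_betw_def generated_group_def)
  have faithful_orbits: "\<phi> = \<one>\<^bsub>generated_group F\<^esub>"
    if t: "t \<in> common_dom F" and \<phi>: "\<phi> \<in> carrier (generated_group F)"
      and fixed: "\<forall>\<psi>\<in>carrier (generated_group F). (\<phi> \<circ>\<^sub>m \<psi>) t = \<psi> t" for t \<phi>
  proof -
    obtain g where g: "g \<in> carrier G" "\<phi> = \<Phi> g" using \<phi> carrier by blast
    have "\<alpha> g (\<alpha> h t) = \<alpha> h t" if h: "h \<in> carrier G" for h
      using fixed g h t maps[OF h] unfolding carrier
      by (auto simp: \<Phi>_def T_def[symmetric] map_comp_def)
    then show ?thesis using separates[of g t] g t \<Phi>_one by (auto simp: T_def)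
  qed
  have "finite F" "\<forall>p\<in>F. pa_rational_homeo n p" using S homeo by (auto simp: F_def)
  moreover have "G \<cong> generated_group F" using iso by (auto simp: is_iso_def)
  moreover have "finitely_generated_group G"
    unfolding finitely_generated_group_def using G S by blast
  ultimately show ?thesis unfolding PA'_recognizable_def using n faithful_orbits by blast
qed


section \<open>Piecewise affine maps of the line\<close>

definition line_pt :: "real \<Rightarrow> nat \<Rightarrow> real" where
  "line_pt x = (\<lambda>i. if i = 0 then x else 0)"

text \<open>
  Transport along the identification of \<open>\<real>\<close> with the space of functions that vanish off index \<open>0\<close>.
\<close>
definition line_lift :: "(real \<rightharpoonup> real) \<Rightarrow> (nat \<Rightarrow> real) \<rightharpoonup> (nat \<Rightarrow> real)" where
  "line_lift h v = (if v \<in> range line_pt then map_option line_pt (h (v 0)) else None)"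

definition piecewise_affine_rational :: "(real \<rightharpoonup> real) \<Rightarrow> bool" where
  "piecewise_affine_rational h \<longleftrightarrow>
     (\<exists>\<J>. finite \<J> \<and> dom h = (\<Union>(p, q)\<in>\<J>. {p..q}) \<and>
        (\<forall>p q. (p, q) \<in> \<J> \<longrightarrow> p \<in> \<rat> \<and> q \<in> \<rat> \<and>
           (\<exists>m\<in>\<rat>. \<exists>b\<in>\<rat>. \<forall>x\<in>{p..q}. h x = Some (m * x + b))))"

lemma piecewise_affine_rationalE:
  assumes "piecewise_affine_rational h"
  obtains \<J> where "finite \<J>" "dom h = (\<Union>(p, q)\<in>\<J>. {p..q})"
    "\<And>p q. (p, q) \<in> \<J> \<Longrightarrow> p \<in> \<rat>" "\<And>p q. (p, q) \<in> \<J> \<Longrightarrow> q \<in> \<rat>"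
    "\<And>p q. (p, q) \<in> \<J> \<Longrightarrow> \<exists>m\<in>\<rat>. \<exists>b\<in>\<rat>. \<forall>x\<in>{p..q}. h x = Some (m * x + b)"
  using assms unfolding piecewise_affine_rational_def by (elim exE conjE) simp

lemma line_pt_0 [simp]: "line_pt x 0 = x"
  by (simp add: line_pt_def)

lemma line_pt_eq_iff [simp]: "line_pt x = line_pt y \<longleftrightarrow> x = y"
  by (metis line_pt_0)

lemma range_line_pt: "range line_pt = topspace (Euclidean_space 1)"
proof -
  have "v = line_pt (v 0)" if "\<forall>i\<ge>1. v i = 0" for v
    using that by (auto simp: line_pt_def fun_eq_iff)
  then show ?thesis
    by (auto simp: topspace_Euclidean_space line_pt_def)
qed

lemma line_lift_line_pt [simp]: "line_lift h (line_pt x) = map_option line_pt (h x)"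
  by (simp add: line_lift_def)

lemma line_lift_eq_SomeE:
  assumes "line_lift h v = Some w"
  obtains x y where "v = line_pt x" "w = line_pt y" "h x = Some y"
  using assms by (auto simp: line_lift_def split: if_splits)

lemma dom_line_lift: "dom (line_lift h) = line_pt ` dom h"
  by (auto simp: line_lift_def dom_def split: if_splits)

lemma line_lift_inverse:
  assumes "\<And>x y. h x = Some y \<longleftrightarrow> k y = Some x"
  shows "line_lift h v = Some w \<longleftrightarrow> line_lift k w = Some v"
proof -
  have "line_lift k w = Some v"
    if "line_lift h v = Some w" "\<And>x y. h x = Some y \<Longrightarrow> k y = Some x" for h k v w
    using that(1) by (rule line_lift_eq_SomeE) (simp add: that(2))
  from this[of h v w k] this[of k w v h] show ?thesis using assms by blast
qed

lemma continuous_map_line_pt: "continuous_map euclideanreal (Euclidean_space 1) line_pt"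
proof -
  have "continuous_map euclideanreal euclideanreal (\<lambda>x. line_pt x i)" for i
    by (cases "i = 0") (auto simp: line_pt_def)
  then show ?thesis
    by (auto simp: Euclidean_space_def continuous_map_in_subtopology
        continuous_map_componentwise_UNIV line_pt_def)
qed

lemma continuous_map_line_coordinate:
  "continuous_map (Euclidean_space 1) euclideanreal (\<lambda>v. v 0)"
  unfolding Euclidean_space_def
  by (intro continuous_map_from_subtopology) (auto intro: continuous_map_product_projection)

lemma bounded_rational_polytope_interval:
  assumes "p \<in> \<rat>" "q \<in> \<rat>"
  shows "bounded_rational_polytope 1 (line_pt ` {p..q})"
proof -
  let ?H = "{(\<lambda>_. 1, q), (\<lambda>_. - 1, - p)} :: ((nat \<Rightarrow> real) \<times> real) set"
  have "line_pt ` {p..q} = {v \<in> range line_pt. \<forall>(a, c)\<in>?H. (\<Sum>i<1. a i * v i) \<le> c}"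
    by auto
  moreover have "\<forall>v\<in>line_pt ` {p..q}. \<forall>i<1. \<bar>v i\<bar> \<le> max \<bar>p\<bar> \<bar>q\<bar>"
    by auto
  moreover have "\<forall>(a, c)\<in>?H. (\<forall>i<1. a i \<in> \<rat>) \<and> c \<in> \<rat>" "finite ?H"
    using assms by auto
  ultimately show ?thesis
    unfolding bounded_rational_polytope_def range_line_pt by blast
qed

lemma rational_polytope_union_line:
  assumes "piecewise_affine_rational h"
  shows "rational_polytope_union 1 (line_pt ` dom h)"
proof -
  obtain \<J> where \<J>: "finite \<J>" "dom h = (\<Union>(p, q)\<in>\<J>. {p..q})"
    and rat: "\<And>p q. (p, q) \<in> \<J> \<Longrightarrow> p \<in> \<rat>" "\<And>p q. (p, q) \<in> \<J> \<Longrightarrow> q \<in> \<rat>"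
    using assms by (elim piecewise_affine_rationalE) (rule that)
  have "line_pt ` dom h = \<Union> ((\<lambda>(p, q). line_pt ` {p..q}) ` \<J>)"
    unfolding \<J>(2) by auto
  then show ?thesis unfolding rational_polytope_union_def
    using \<J>(1) bounded_rational_polytope_interval[OF rat]
    by (intro exI[of _ "(\<lambda>(p, q). line_pt ` {p..q}) ` \<J>"]) auto
qed

text \<open>
  The pieces are closed and finite in number, so continuity on each of them suffices.
\<close>
lemma continuous_on_piecewise_affine_rational:
  assumes "piecewise_affine_rational h"
  shows "continuous_on (dom h) (\<lambda>x. the (h x))"
proof -
  obtain \<J> where \<J>: "finite \<J>" "dom h = (\<Union>(p, q)\<in>\<J>. {p..q})"
    and aff: "\<And>p q. (p, q) \<in> \<J> \<Longrightarrow> \<exists>m\<in>\<rat>. \<exists>b\<in>\<rat>. \<forall>x\<in>{p..q}. h x = Some (m * x + b)"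
    using assms by (elim piecewise_affine_rationalE) (rule that)
  have "continuous_on (case j of (p, q) \<Rightarrow> {p..q}) (\<lambda>x. the (h x))" if j_in: "j \<in> \<J>" for j
  proof -
    obtain p q where j: "j = (p, q)" by (cases j)
    then obtain m b where h: "\<forall>x\<in>{p..q}. h x = Some (m * x + b)"
      using aff j_in by blast
    have "continuous_on {p..q} (\<lambda>x. m * x + b)" by (intro continuous_intros)
    then have "continuous_on {p..q} (\<lambda>x. the (h x))"
      using h by (subst continuous_on_cong[OF refl]) auto
    then show ?thesis by (simp add: j)
  qed
  then show ?thesis unfolding \<J>(2)
    using \<J>(1) by (intro continuous_on_closed_Union) auto
qed

lemma continuous_map_line_lift:
  assumes "piecewise_affine_rational h"
  shows "continuous_map (subtopology (Euclidean_space 1) (dom (line_lift h)))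
    (subtopology (Euclidean_space 1) (ran (line_lift h))) (\<lambda>v. the (line_lift h v))"
proof -
  let ?X = "subtopology (Euclidean_space 1) (dom (line_lift h))"
  have "continuous_map ?X (top_of_set (dom h)) (\<lambda>v. v 0)"
    using continuous_map_from_subtopology[OF continuous_map_line_coordinate]
    by (auto simp: continuous_map_in_subtopology dom_line_lift)
  moreover have "continuous_map (top_of_set (dom h)) euclideanreal (\<lambda>x. the (h x))"
    using continuous_on_piecewise_affine_rational[OF assms] by simp
  ultimately have "continuous_map ?X (Euclidean_space 1) (line_pt \<circ> ((\<lambda>x. the (h x)) \<circ> (\<lambda>v. v 0)))"
    by (intro continuous_map_compose[OF _ continuous_map_line_pt]) (rule continuous_map_compose)
  then have "continuous_map ?X (Euclidean_space 1) (\<lambda>v. the (line_lift h v))"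
    by (rule continuous_map_eq) (auto simp: dom_line_lift)
  then show ?thesis
    by (auto simp: continuous_map_in_subtopology ran_def)
qed

text \<open>
  The inverse \<open>k\<close> has to be piecewise affine in its own right: this provides the decomposition of the
  range into polytopes and the continuity of the inverse.
\<close>
lemma pa_rational_homeo_line_lift:
  assumes h: "piecewise_affine_rational h" and k: "piecewise_affine_rational k"
    and inverse: "\<And>x y. h x = Some y \<longleftrightarrow> k y = Some x"
  shows "pa_rational_homeo 1 (line_lift h)"
proof -
  let ?f = "line_lift h" and ?g = "line_lift k"
  have fg: "?f v = Some w \<longleftrightarrow> ?g w = Some v" for v w
    using inverse by (rule line_lift_inverse)
  have ran: "ran ?f = dom ?g" "ran ?g = dom ?f"
    using fg by (auto simp: ran_def)
  have round_trip: "\<forall>v\<in>dom ?f. the (?g (the (?f v))) = v" "\<forall>w\<in>dom ?g. the (?f (the (?g w))) = w"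
    using fg by (metis domD option.sel)+
  have "homeomorphic_maps (subtopology (Euclidean_space 1) (dom ?f))
      (subtopology (Euclidean_space 1) (ran ?f)) (\<lambda>v. the (?f v)) (\<lambda>v. the (?g v))"
    using continuous_map_line_lift[OF h] continuous_map_line_lift[OF k] round_trip
    unfolding homeomorphic_maps_def ran by simp
  then have homeo: "homeomorphic_map (subtopology (Euclidean_space 1) (dom ?f))
      (subtopology (Euclidean_space 1) (ran ?f)) (\<lambda>v. the (?f v))"
    using homeomorphic_map_maps by blast
  obtain \<J> where \<J>: "finite \<J>" "dom h = (\<Union>(p, q)\<in>\<J>. {p..q})"
    and rat: "\<And>p q. (p, q) \<in> \<J> \<Longrightarrow> p \<in> \<rat>" "\<And>p q. (p, q) \<in> \<J> \<Longrightarrow> q \<in> \<rat>"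
    and aff: "\<And>p q. (p, q) \<in> \<J> \<Longrightarrow> \<exists>m\<in>\<rat>. \<exists>b\<in>\<rat>. \<forall>x\<in>{p..q}. h x = Some (m * x + b)"
    using h by (elim piecewise_affine_rationalE) (rule that)
  have piece: "affine_rational_on 1 (line_pt ` {p..q}) ?f" if pq: "(p, q) \<in> \<J>" for p q
  proof -
    obtain m b where mb: "m \<in> \<rat>" "b \<in> \<rat>" "\<forall>x\<in>{p..q}. h x = Some (m * x + b)"
      using aff[OF pq] by blast
    then show ?thesis unfolding affine_rational_on_def
      by (intro exI[of _ "\<lambda>_ _. m"] exI[of _ "\<lambda>_. b"]) (auto simp: line_pt_def[of "_ + _"] fun_eq_iff)
  qed
  have "dom ?f = \<Union> ((\<lambda>(p, q). line_pt ` {p..q}) ` \<J>)"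
    unfolding dom_line_lift \<J>(2) by auto
  then have "\<exists>\<P>. finite \<P> \<and> dom ?f = \<Union>\<P> \<and>
      (\<forall>P\<in>\<P>. bounded_rational_polytope 1 P \<and> affine_rational_on 1 P ?f)"
    using \<J>(1) piece bounded_rational_polytope_interval[OF rat]
    by (intro exI[of _ "(\<lambda>(p, q). line_pt ` {p..q}) ` \<J>"]) auto
  then show ?thesis unfolding pa_rational_homeo_def
    using homeo rational_polytope_union_line[OF k] ran dom_line_lift by auto
qed


section \<open>Finite groups\<close>

text \<open>
  Left multiplication by \<open>g\<close> sends the point \<open>e a\<close> to \<open>e (g \<otimes> a)\<close>, for an injection \<open>e\<close> of the carrier
  into the naturals. Its affine pieces are single points, where a constant map is affine.
\<close>
lemma PA'_recognizable_finite_group: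
  fixes G :: "('a, 'b) monoid_scheme" (structure)
  assumes "group G" and fin: "finite (carrier G)"
  shows "PA'_recognizable G"
proof -
  interpret group G by fact
  obtain e :: "'a \<Rightarrow> nat" where e: "inj_on e (carrier G)"
    using fin finite_imp_inj_to_nat_seg by blast
  define h where "h g x = (if x \<in> (\<lambda>a. real (e a)) ` carrier G
    then Some (real (e (g \<otimes> inv_into (carrier G) (\<lambda>a. real (e a)) x))) else None)" for g x
  have e': "inj_on (\<lambda>a. real (e a)) (carrier G)" using e by (auto simp: inj_on_def)
  have h_e: "h g (real (e a)) = Some (real (e (g \<otimes> a)))" if "a \<in> carrier G" for g a
    using that inv_into_f_f[OF e'] by (auto simp: h_def)
  have h_cases: "\<exists>a\<in>carrier G. x = real (e a) \<and> y = real (e (g \<otimes> a))" if "h g x = Some y" for g x y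
    using that h_e by (auto simp: h_def split: if_splits)
  have inv1: "h (inv g) y = Some x" if g: "g \<in> carrier G" and xy: "h g x = Some y" for g x y
  proof -
    obtain a where a: "a \<in> carrier G" "x = real (e a)" "y = real (e (g \<otimes> a))"
      using h_cases[OF xy] by blast
    then show ?thesis using g h_e[of "g \<otimes> a" "inv g"] by (simp add: m_assoc[symmetric])
  qed
  have inverse: "h g x = Some y \<longleftrightarrow> h (inv g) y = Some x" if g: "g \<in> carrier G" for g x y
    using inv1[of g x y] inv1[of "inv g" y x] g by auto
  have pw: "piecewise_affine_rational (h g)" if "g \<in> carrier G" for g
  proof -
    let ?J = "(\<lambda>a. (real (e a), real (e a))) ` carrier G"
    have "dom (h g) = (\<Union>(p, q)\<in>?J. {p..q})" by (auto simp: h_def split: if_splits)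
    moreover have "\<exists>m\<in>\<rat>. \<exists>b\<in>\<rat>. \<forall>x\<in>{real (e a)..real (e a)}. h g x = Some (m * x + b)"
      if "a \<in> carrier G" for a
      using h_e[OF that] by (intro bexI[of _ 0] bexI[of _ "real (e (g \<otimes> a))"]) auto
    ultimately show ?thesis unfolding piecewise_affine_rational_def using fin
      by (intro exI[of _ ?J]) auto
  qed
  define f where "f g = line_lift (h g)" for g
  define T where "T = line_pt ` (\<lambda>a. real (e a)) ` carrier G"
  have f_e: "f g (line_pt (real (e a))) = Some (line_pt (real (e (g \<otimes> a))))" if "a \<in> carrier G" for g a
    using that h_e by (simp add: f_def)
  have sub: "common_dom (f ` carrier G) \<subseteq> T"
  proof -
    have "f \<one> \<in> partial_closure (f ` carrier G)" by (auto intro: partial_closure.gen)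
    then have "common_dom (f ` carrier G) \<subseteq> dom (f \<one>)" by (auto simp: common_dom_def)
    also have "\<dots> \<subseteq> T" by (auto simp: f_def dom_line_lift T_def h_def split: if_splits)
    finally show ?thesis .
  qed
  show ?thesis
  proof (rule PA'_recognizable_if_action[where S = "carrier G" and n = 1 and f = f and L = T
        and \<alpha> = "\<lambda>g t. the (f g t)"])
    show "generate G (carrier G) = carrier G"
      using generate_incl[of "carrier G"] by (auto intro: generate.incl)
    show "carrier G \<noteq> {}" using one_closed by blast
    show "pa_rational_homeo 1 (f g)" if "g \<in> carrier G" for g
      unfolding f_def using pw[OF that] pw[OF inv_closed[OF that]] inverse[OF that]
      by (rule pa_rational_homeo_line_lift)
    show "pinv (f g) = f (inv g)" if "g \<in> carrier G" for g
      unfolding f_def using inverse[OF that] by (intro pinv_eqI line_lift_inverse)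
    show "T \<noteq> {}" using one_closed by (auto simp: T_def)
    show "\<exists>u\<in>T. f g t = Some u" if "g \<in> carrier G" "t \<in> T" for g t
      using that f_e by (auto simp: T_def)
    show "the (f \<one> t) = t" if "t \<in> common_dom (f ` carrier G)" for t
      using that sub f_e by (auto simp: T_def)
    show "the (f (g \<otimes> k) t) = the (f g (the (f k t)))"
      if "g \<in> carrier G" "k \<in> carrier G" "t \<in> common_dom (f ` carrier G)" for g k t
      using that sub f_e by (auto simp: T_def m_assoc)
    show "f g t = Some (the (f g t))" if "g \<in> carrier G" "t \<in> common_dom (f ` carrier G)" for g t
      using that sub f_e by (auto simp: T_def)
    show "\<exists>k\<in>carrier G. the (f g (the (f k t))) \<noteq> the (f k t)"
      if "g \<in> carrier G" "g \<noteq> \<one>" "t \<in> common_dom (f ` carrier G)" for g t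
    proof -
      obtain a where a: "a \<in> carrier G" "t = line_pt (real (e a))"
        using subsetD[OF sub \<open>t \<in> common_dom (f ` carrier G)\<close>] by (auto simp: T_def)
      have "e (g \<otimes> a) \<noteq> e a"
        using that a e by (metis inj_onD m_closed r_cancel_one)
      then show ?thesis using a f_e by (intro bexI[of _ \<one>]) auto
    qed
  qed (use fin assms in auto)
qed


section \<open>The group of reduced words\<close>

lemma letter_inv_letter_inv [simp]: "letter_inv (letter_inv l) = l"
  by (simp add: letter_inv_def)

lemma letter_inv_in_iff [simp]: "letter_inv l \<in> X \<times> UNIV \<longleftrightarrow> l \<in> X \<times> UNIV"
  by (cases l) (simp add: letter_inv_def)

lemma reduced_Nil [simp]: "reduced []"
  by (simp add: reduced_def)

lemma reduced_Cons: "reduced (l # w) \<longleftrightarrow> (w = [] \<or> hd w \<noteq> letter_inv l) \<and> reduced w"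
  by (auto simp: reduced_def successively_Cons)

lemma reduced_cons_cancel: "reduced w \<Longrightarrow> reduced (cons_cancel l w)"
  by (cases w) (auto simp: reduced_Cons)

lemma set_cons_cancel: "set (cons_cancel l w) \<subseteq> insert l (set w)"
  by (cases w) auto

lemma cons_cancel_reduced: "reduced (l # w) \<Longrightarrow> cons_cancel l w = l # w"
  by (cases w) (auto simp: reduced_Cons)

lemma cons_cancel_letter_inv:
  "reduced w \<Longrightarrow> cons_cancel l (cons_cancel (letter_inv l) w) = w"
  by (cases w) (auto simp: cons_cancel_reduced reduced_Cons)

lemma reduced_foldr_cons_cancel: "reduced w \<Longrightarrow> reduced (foldr cons_cancel v w)"
  by (induction v) (auto intro: reduced_cons_cancel)

lemma set_foldr_cons_cancel: "set (foldr cons_cancel v w) \<subseteq> set v \<union> set w"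
  using set_cons_cancel by (induction v) fastforce+

text \<open>
  The universal property that is behind associativity as well as the action on the line: if the
  letters act on \<open>T\<close> with inverse letters acting inversely, then a cancelling pair does not change the
  action of a word, so that multiplication of words acts by composition. Associativity is the
  case where \<open>T\<close> is the set of reduced words and the letters act by \<open>cons_cancel\<close>.
\<close>
lemma foldr_cons_cancel_action:
  assumes inverse: "\<And>l t. l \<in> X \<times> UNIV \<Longrightarrow> t \<in> T \<Longrightarrow> \<beta> l (\<beta> (letter_inv l) t) = t"
    and closed: "\<And>l t. l \<in> X \<times> UNIV \<Longrightarrow> t \<in> T \<Longrightarrow> \<beta> l t \<in> T"
    and t: "t \<in> T" and v: "set v \<subseteq> X \<times> UNIV" and w: "set w \<subseteq> X \<times> UNIV"
  shows "foldr \<beta> (foldr cons_cancel v w) t = foldr \<beta> v (foldr \<beta> w t)"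
proof -
  have stays: "foldr \<beta> u t \<in> T" if "set u \<subseteq> X \<times> UNIV" for u
    using that t closed by (induction u) auto
  have step: "foldr \<beta> (cons_cancel l u) t = \<beta> l (foldr \<beta> u t)"
    if "l \<in> X \<times> UNIV" "set u \<subseteq> X \<times> UNIV" for l u
  proof (cases u)
    case (Cons k u')
    then show ?thesis using that inverse stays[of u'] by auto
  qed simp
  show ?thesis using v
  proof (induction v)
    case (Cons l v)
    have "set (foldr cons_cancel v w) \<subseteq> X \<times> UNIV"
      using set_foldr_cons_cancel[of v w] Cons.prems w by auto
    then show ?case using Cons step by simp
  qed simp
qed

lemma free_group_simps:
  "carrier (free_group X) = {w. set w \<subseteq> X \<times> UNIV \<and> reduced w}"
  "v \<otimes>\<^bsub>free_group X\<^esub> w = foldr cons_cancel v w"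
  "\<one>\<^bsub>free_group X\<^esub> = []"
  by (auto simp: free_group_def)

lemma group_free_group: "group (free_group X)"
proof (rule groupI, goal_cases)
  case (1 v w)
  then show ?case
    using set_foldr_cons_cancel[of v w] by (auto simp: free_group_simps reduced_foldr_cons_cancel)
next
  case (3 u v w)
  then show ?case unfolding free_group_simps
    by (intro foldr_cons_cancel_action[where X = X and T = "{w. reduced w}"])
      (auto intro: reduced_cons_cancel cons_cancel_letter_inv)
next
  case (5 w)
  have "foldr cons_cancel (rev (map letter_inv w)) w = []" for w :: "('a \<times> bool) list"
    by (induction w) auto
  moreover have "reduced (rev (map letter_inv w))" if "reduced w"
    using that unfolding reduced_def successively_rev successively_map
    by (rule successively_mono) (metis letter_inv_letter_inv)
  moreover have "set (rev (map letter_inv w)) \<subseteq> X \<times> UNIV" if "set w \<subseteq> X \<times> UNIV"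
    using that unfolding set_rev set_map image_subset_iff letter_inv_in_iff by blast
  ultimately show ?case using 5 unfolding free_group_simps
    by (intro bexI[of _ "rev (map letter_inv w)"]) blast+
qed (auto simp: free_group_simps)

lemma letter_in_free_group: "l \<in> X \<times> UNIV \<Longrightarrow> [l] \<in> carrier (free_group X)"
  by (auto simp: free_group_simps reduced_Cons)

lemma inv_free_group_letter:
  assumes "l \<in> X \<times> UNIV"
  shows "inv\<^bsub>free_group X\<^esub> [l] = [letter_inv l]"
proof -
  interpret group "free_group X" by (rule group_free_group)
  show ?thesis
    using assms by (intro inv_equality letter_in_free_group) (auto simp: free_group_simps)
qed

lemma generate_free_group:
  "generate (free_group X) ((\<lambda>l. [l]) ` (X \<times> UNIV)) = carrier (free_group X)"
proof
  interpret group "free_group X" by (rule group_free_group)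
  let ?S = "(\<lambda>l. [l]) ` (X \<times> UNIV)"
  show "generate (free_group X) ?S \<subseteq> carrier (free_group X)"
    using letter_in_free_group by (intro generate_incl) blast
  show "carrier (free_group X) \<subseteq> generate (free_group X) ?S"
  proof
    fix w assume "w \<in> carrier (free_group X)"
    then show "w \<in> generate (free_group X) ?S"
    proof (induction w)
      case Nil
      then show ?case using generate.one[of "free_group X" ?S] by (simp add: free_group_simps)
    next
      case (Cons l w)
      then have "[l] \<otimes>\<^bsub>free_group X\<^esub> w \<in> generate (free_group X) ?S"
        by (intro generate.eng generate.incl[of "[l]"]) (auto simp: free_group_simps reduced_Cons)
      then show ?case using Cons.prems by (simp add: free_group_simps cons_cancel_reduced)
    qed
  qed
qed


section \<open>Ping-pong for the free group of rank two\<close>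

abbreviation letters :: "(nat \<times> bool) set" where
  "letters \<equiv> {0, 1} \<times> UNIV"

text \<open>
  The four letters get the offsets \<open>0, 2, 4, 6\<close>. As they differ by at least \<open>2\<close> and are at most \<open>6\<close>, the
  images of \<open>[0, 1]\<close> under \<open>x \<mapsto> (x + offset l) / 7\<close> are disjoint closed subintervals of \<open>[0, 1]\<close>.
\<close>
definition offset :: "nat \<times> bool \<Rightarrow> real" where
  "offset l = 4 * real (fst l) + (if snd l then 2 else 0)"

definition contract :: "nat \<times> bool \<Rightarrow> real \<Rightarrow> real" where
  "contract l x = (x + offset l) / 7"

definition cell :: "nat \<times> bool \<Rightarrow> real set" where
  "cell l = {offset l / 7 .. (offset l + 1) / 7}"

text \<open>
  Left multiplication by \<open>l\<close> on addresses: where the first letter \<open>m\<close> is not inverse to \<open>l\<close>, the letter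
  \<open>l\<close> is prepended; otherwise the first letter is removed, and what remains must not begin with \<open>l\<close>.
\<close>
definition letter_map :: "nat \<times> bool \<Rightarrow> real \<rightharpoonup> real" where
  "letter_map l x =
     (if \<exists>m\<in>letters. m \<noteq> letter_inv l \<and> x \<in> cell m then Some (contract l x)
      else if \<exists>m\<in>letters. m \<noteq> l \<and> 7 * x - offset (letter_inv l) \<in> cell m
      then Some (7 * x - offset (letter_inv l))
      else None)"

lemma cell_disjoint:
  assumes "x \<in> cell l" "x \<in> cell m"
  shows "l = m"
proof -
  define i where "i l = 4 * int (fst l) + (if snd l then 2 else 0)" for l :: "nat \<times> bool"
  have off: "offset l = real_of_int (i l)" for l by (simp add: offset_def i_def)
  have "real_of_int (i l) < real_of_int (i m + 2)" "real_of_int (i m) < real_of_int (i l + 2)"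
    using assms by (auto simp: cell_def off)
  then have "i l < i m + 2" "i m < i l + 2" by linarith+
  then show ?thesis
    by (auto simp: i_def prod_eq_iff split: if_splits)
qed

lemma cell_subset_unit: "l \<in> letters \<Longrightarrow> cell l \<subseteq> {0..1}"
  by (auto simp: cell_def offset_def)

lemma contract_in_cell: "0 \<le> x \<Longrightarrow> x \<le> 1 \<Longrightarrow> contract l x \<in> cell l"
  by (auto simp: cell_def contract_def)

lemma letter_map_forward:
  "m \<in> letters \<Longrightarrow> m \<noteq> letter_inv l \<Longrightarrow> x \<in> cell m \<Longrightarrow> letter_map l x = Some (contract l x)"
  by (auto simp: letter_map_def)

lemma letter_map_backward:
  assumes m: "m \<in> letters" "m \<noteq> letter_inv l" "x \<in> cell m"
  shows "letter_map (letter_inv l) (contract l x) = Some x"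
proof -
  have "x \<in> {0..1}" using m cell_subset_unit by blast
  then have "contract l x \<in> cell l" by (simp add: contract_in_cell)
  then have "\<not> (\<exists>k\<in>letters. k \<noteq> l \<and> contract l x \<in> cell k)"
    using cell_disjoint by blast
  moreover have x: "7 * contract l x - offset l = x" by (simp add: contract_def field_simps)
  moreover have "\<exists>k\<in>letters. k \<noteq> letter_inv l \<and> 7 * contract l x - offset l \<in> cell k"
    unfolding x using m by blast
  ultimately show ?thesis unfolding letter_map_def letter_inv_letter_inv by (simp only: if_True if_False)
qed

lemma letter_map_SomeE:
  assumes "letter_map l x = Some y"
  obtains m where "m \<in> letters" "m \<noteq> letter_inv l" "x \<in> cell m" "y = contract l x"
  | m where "m \<in> letters" "m \<noteq> l" "y \<in> cell m" "x = contract (letter_inv l) y"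
proof (cases "\<exists>m\<in>letters. m \<noteq> letter_inv l \<and> x \<in> cell m")
  case True
  then have "y = contract l x" using assms by (simp only: letter_map_def if_True option.inject)
  then show ?thesis using True that(1) by blast
next
  case False
  let ?y = "7 * x - offset (letter_inv l)"
  have y: "(if \<exists>m\<in>letters. m \<noteq> l \<and> ?y \<in> cell m then Some ?y else None) = Some y"
    using assms False by (simp only: letter_map_def if_False)
  then have "\<exists>m\<in>letters. m \<noteq> l \<and> ?y \<in> cell m" by (metis option.distinct(1))
  moreover from this have "y = ?y" using y by (simp only: if_True option.inject)
  moreover from this have "x = contract (letter_inv l) y" by (simp add: contract_def)
  ultimately show ?thesis using that(2) by blast
qed

text \<open>
  Prepending \<open>l\<close> and removing it again swap the two branches of the definition.
\<close>
lemma letter_map_inverse: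
  "letter_map l x = Some y \<longleftrightarrow> letter_map (letter_inv l) y = Some x"
proof -
  have "letter_map (letter_inv l) y = Some x" if "letter_map l x = Some y" for l x y
    using that
  proof (cases rule: letter_map_SomeE)
    case (1 m)
    then show ?thesis using letter_map_backward by simp
  next
    case (2 m)
    then show ?thesis using letter_map_forward[of m "letter_inv l" y] by simp
  qed
  from this[of l x y] this[of "letter_inv l" y x] show ?thesis by auto
qed

lemma letter_map_domE:
  assumes "l \<in> letters" "x \<in> dom (letter_map l)"
  obtains m where "m \<in> letters" "x \<in> cell m"
proof -
  obtain y where "letter_map l x = Some y" using assms by auto
  then show ?thesis
  proof (cases rule: letter_map_SomeE)
    case (2 m)
    then have "x \<in> cell (letter_inv l)"
      using subsetD[OF cell_subset_unit] by (auto intro: contract_in_cell)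
    then show ?thesis using that assms letter_inv_in_iff by blast
  qed (rule that)
qed

text \<open>
  The two families of pieces are the cells on which \<open>l\<close> is prepended, with slope \<open>1 / 7\<close>, and the
  subintervals of the cell of the inverse letter on which that letter is removed, with slope \<open>7\<close>.
\<close>
lemma piecewise_affine_rational_letter_map: "piecewise_affine_rational (letter_map l)"
proof -
  let ?c = "contract (letter_inv l)"
  let ?A = "(\<lambda>m. (offset m / 7, (offset m + 1) / 7)) ` {m \<in> letters. m \<noteq> letter_inv l}"
  let ?B = "(\<lambda>m. (?c (offset m / 7), ?c ((offset m + 1) / 7))) ` {m \<in> letters. m \<noteq> l}"
  have off: "offset m \<in> \<rat>" for m by (auto simp: offset_def)
  have B: "x \<in> {?c (offset m / 7) .. ?c ((offset m + 1) / 7)} \<longleftrightarrow>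
      7 * x - offset (letter_inv l) \<in> cell m" for x m
    by (auto simp: contract_def cell_def field_simps)
  have expand: "letter_map l x = Some (7 * x - offset (letter_inv l))"
    if "m \<in> letters" "m \<noteq> l" "7 * x - offset (letter_inv l) \<in> cell m" for m x
    using letter_map_backward[of m "letter_inv l" "7 * x - offset (letter_inv l)"] that
    by (simp add: contract_def)
  have "dom (letter_map l) = (\<Union>(p, q)\<in>?A \<union> ?B. {p..q})" (is "_ = ?U")
  proof -
    have if_defined: "(if A then Some a else if B then Some b else None) \<noteq> None \<longleftrightarrow> A \<or> B"
      for A B and a b :: real by simp
    have dom_iff: "x \<in> dom (letter_map l) \<longleftrightarrow> (\<exists>m\<in>letters. m \<noteq> letter_inv l \<and> x \<in> cell m) \<or>
      (\<exists>m\<in>letters. m \<noteq> l \<and> 7 * x - offset (letter_inv l) \<in> cell m)" for x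
      unfolding letter_map_def domIff by (rule if_defined)
    have U: "?U = (\<Union>m\<in>{m \<in> letters. m \<noteq> letter_inv l}. cell m) \<union>
      (\<Union>m\<in>{m \<in> letters. m \<noteq> l}. {?c (offset m / 7) .. ?c ((offset m + 1) / 7)})"
      unfolding cell_def by (simp only: UN_Un image_image prod.case)
    show ?thesis
      unfolding U by (rule Set.set_eqI) (simp only: dom_iff Un_iff UN_iff B Bex_def mem_Collect_eq conj_assoc)
  qed
  moreover have "finite (?A \<union> ?B)" by simp
  moreover have "p \<in> \<rat> \<and> q \<in> \<rat> \<and> (\<exists>a\<in>\<rat>. \<exists>b\<in>\<rat>. \<forall>x\<in>{p..q}. letter_map l x = Some (a * x + b))"
    if "(p, q) \<in> ?A \<union> ?B" for p q
    using that
  proof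
    assume "(p, q) \<in> ?A"
    then obtain m where m: "m \<in> letters" "m \<noteq> letter_inv l" "p = offset m / 7" "q = (offset m + 1) / 7"
      by blast
    have "\<forall>x\<in>{p..q}. letter_map l x = Some (1 / 7 * x + offset l / 7)"
      using letter_map_forward[of m l] m by (auto simp: cell_def contract_def add_divide_distrib)
    moreover have "p \<in> \<rat>" "q \<in> \<rat>" unfolding m(3,4) using off by (simp_all add: Rats_divide)
    moreover have "1 / 7 \<in> (\<rat> :: real set)" "offset l / 7 \<in> \<rat>" using off by (simp_all add: Rats_divide)
    ultimately show ?thesis by blast
  next
    assume "(p, q) \<in> ?B"
    then obtain m where m: "m \<in> letters" "m \<noteq> l" "p = ?c (offset m / 7)" "q = ?c ((offset m + 1) / 7)"
      by blast
    have "\<forall>x\<in>{p..q}. letter_map l x = Some (7 * x + - offset (letter_inv l))"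
      using expand[of m] m B[of _ m] by auto
    moreover have "p \<in> \<rat>" "q \<in> \<rat>"
      unfolding m(3,4) contract_def using off by (simp_all add: Rats_divide Rats_add)
    moreover have "7 \<in> (\<rat> :: real set)" "- offset (letter_inv l) \<in> \<rat>" using off by simp_all
    ultimately show ?thesis by blast
  qed
  ultimately show ?thesis unfolding piecewise_affine_rational_def by blast
qed

text \<open>
  The point reached from \<open>0\<close> has the address \<open>w z z z \<dots>\<close> with \<open>z = (0, False)\<close>, because \<open>0\<close> is the fixed
  point of the contraction of \<open>z\<close>. This is why the letter \<open>z\<close> is appended to find the first letter.
\<close>
lemma foldr_contract_in_cell:
  assumes "set w \<subseteq> letters"
  shows "foldr contract w 0 \<in> cell (hd (w @ [(0, False)]))"
  using assms
proof (induction w)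
  case Nil
  then show ?case by (simp add: cell_def offset_def)
next
  case (Cons l w)
  have hd: "hd (w @ [(0, False)]) \<in> letters" using Cons.prems by (cases w) auto
  have "foldr contract w 0 \<in> cell (hd (w @ [(0, False)]))" using Cons by simp
  then have "foldr contract w 0 \<in> {0..1}" using cell_subset_unit[OF hd] by blast
  then show ?case using contract_in_cell by simp
qed

text \<open>
  The points whose address is reduced and eventually constant with value \<open>(0, False)\<close>.
\<close>
definition limit_points :: "real set" where
  "limit_points = {foldr contract w 0 | w. set w \<subseteq> letters \<and> reduced (w @ [(0, False)])}"

text \<open>
  Prepending or removing a letter keeps an address reduced and eventually constant.
\<close>
lemma letter_map_limit_points:
  assumes l: "l \<in> letters" and x: "x \<in> limit_points"
  obtains y where "y \<in> limit_points" "letter_map l x = Some y"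
proof -
  let ?z = "(0, False) :: nat \<times> bool"
  obtain w where w: "set w \<subseteq> letters" "reduced (w @ [?z])" and x: "x = foldr contract w 0"
    using x by (auto simp: limit_points_def)
  have cell: "x \<in> cell (hd (w @ [?z]))" using foldr_contract_in_cell w x by blast
  have hd: "hd (u @ [?z]) \<in> letters" if "set u \<subseteq> letters" for u using that by (cases u) auto
  show ?thesis
  proof (cases "hd (w @ [?z]) = letter_inv l")
    case False
    then have "letter_map l x = Some (contract l x)"
      using letter_map_forward hd w cell by blast
    moreover have "contract l x \<in> limit_points"
      unfolding limit_points_def using False l w x
      by (intro CollectI exI[of _ "l # w"]) (auto simp: reduced_Cons)
    ultimately show ?thesis using that by blast
  next
    case True
    \<comment> \<open>Removing the first letter leaves \<open>u\<close>. For empty \<open>w\<close> this letter is \<open>?z\<close>, and \<open>u\<close> is empty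
      too, as \<open>0\<close> is the fixed point of \<open>contract ?z\<close>.\<close>
    obtain u where u: "set u \<subseteq> letters" "reduced (u @ [?z])" "x = contract (letter_inv l) (foldr contract u 0)"
      "hd (u @ [?z]) \<noteq> l"
    proof (cases w)
      case Nil
      then show ?thesis using that[of "[]"] True x
        by (cases l) (auto simp: contract_def offset_def reduced_Cons letter_inv_def)
    next
      case (Cons k u)
      then show ?thesis using that[of u] True x w
        by (auto simp: reduced_Cons letter_inv_def prod_eq_iff)
    qed
    have "letter_map l x = Some (foldr contract u 0)"
      using letter_map_backward[of "hd (u @ [?z])" "letter_inv l"] u hd foldr_contract_in_cell[OF u(1)]
      by simp
    then show ?thesis using that u by (auto simp: limit_points_def)
  qed
qed

lemma PA'_recognizable_free_group_2: "PA'_recognizable (free_group {0, 1 :: nat})"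
proof -
  define G where "G = free_group {0, 1 :: nat}"
  define S where "S = (\<lambda>l :: nat \<times> bool. [l]) ` letters"
  define f where "f w = line_lift (letter_map (hd w))" for w
  define T where "T = common_dom (f ` S)"
  define \<beta> where "\<beta> l v = the (line_lift (letter_map l) v)" for l v
  have f_in: "line_lift (letter_map l) \<in> partial_closure (f ` S)" if "l \<in> letters" for l
  proof -
    have "[l] \<in> S" using that unfolding S_def by blast
    then have "f [l] \<in> partial_closure (f ` S)" by (intro partial_closure.gen imageI)
    then show ?thesis by (simp add: f_def)
  qed
  have \<beta>: "line_lift (letter_map l) t = Some (\<beta> l t)" "\<beta> l t \<in> T"
    if l: "l \<in> letters" and t: "t \<in> T" for l t
  proof -
    obtain u where "u \<in> T" "line_lift (letter_map l) t = Some u"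
      using f_in[OF l] t unfolding T_def by (rule partial_closure_common_dom)
    then show "line_lift (letter_map l) t = Some (\<beta> l t)" "\<beta> l t \<in> T"
      by (simp_all add: \<beta>_def)
  qed
  have lift_inverse: "line_lift (letter_map l) v = Some w \<longleftrightarrow>
      line_lift (letter_map (letter_inv l)) w = Some v" for l v w
    using letter_map_inverse by (rule line_lift_inverse)
  have \<beta>_inverse: "\<beta> l (\<beta> (letter_inv l) t) = t" if "l \<in> letters" "t \<in> T" for l t
  proof -
    have "letter_inv l \<in> letters" using that(1) by (simp only: letter_inv_in_iff)
    then have "line_lift (letter_map (letter_inv l)) t = Some (\<beta> (letter_inv l) t)"
      using that(2) by (rule \<beta>(1))
    then have "line_lift (letter_map l) (\<beta> (letter_inv l) t) = Some t"
      by (simp only: lift_inverse[of l])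
    then show ?thesis unfolding \<beta>_def[of l] by simp
  qed
  have in_cell: "\<exists>m\<in>letters. t \<in> line_pt ` cell m" if t: "t \<in> T" for t
  proof -
    have l: "(0, False) \<in> letters" by simp
    obtain x y where xy: "t = line_pt x" "letter_map (0, False) x = Some y"
      using \<beta>(1)[OF l t] by (elim line_lift_eq_SomeE)
    obtain m where "m \<in> letters" "x \<in> cell m"
      using letter_map_domE[OF l, of x] xy by blast
    then show ?thesis using xy by blast
  qed
  have cells_disjoint: "l = m" if "t \<in> line_pt ` cell l" "t \<in> line_pt ` cell m" for l m t
    using that by (auto dest: cell_disjoint)
  have ping: "\<beta> l t \<in> line_pt ` cell l"
    if "m \<in> letters" "m \<noteq> letter_inv l" "t \<in> line_pt ` cell m" for l m t
  proof -
    obtain x where x: "t = line_pt x" "x \<in> cell m" using \<open>t \<in> line_pt ` cell m\<close> by blast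
    then have "\<beta> l t = line_pt (contract l x)"
      using letter_map_forward[OF that(1,2)] by (simp add: \<beta>_def)
    moreover have "contract l x \<in> cell l"
      using subsetD[OF cell_subset_unit[OF that(1)] x(2)] by (simp add: contract_in_cell)
    ultimately show ?thesis by blast
  qed
  \<comment> \<open>The letters of \<open>w\<close> act from the last to the first, and reducedness allows \<open>ping\<close> at each step.\<close>
  have pong: "foldr \<beta> w t \<in> line_pt ` cell (hd w)"
    if "w \<noteq> []" "set w \<subseteq> letters" "reduced w" "m \<in> letters" "m \<noteq> letter_inv (last w)"
      "t \<in> line_pt ` cell m" for w m t
    using that
  proof (induction w)
    case (Cons l w)
    show ?case
    proof (cases "w = []")
      case True
      then show ?thesis using Cons.prems ping[of m l t] by simp
    next
      case False
      have "foldr \<beta> w t \<in> line_pt ` cell (hd w)"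
        using Cons.prems False by (intro Cons.IH) (simp_all add: reduced_Cons)
      moreover have "hd w \<in> letters" using Cons.prems(2) hd_in_set[OF False] by auto
      moreover have "hd w \<noteq> letter_inv l" using Cons.prems(3) False by (simp add: reduced_Cons)
      ultimately show ?thesis using ping[of "hd w" l] by simp
    qed
  qed simp
  have "PA'_recognizable G"
  proof (rule PA'_recognizable_if_action[where S = S and n = 1 and f = f and \<alpha> = "foldr \<beta>"
        and L = "line_pt ` limit_points"], fold T_def)
    show "group G" unfolding G_def by (rule group_free_group)
    show "generate G S = carrier G" unfolding G_def S_def by (rule generate_free_group)
    show "S \<subseteq> carrier G" unfolding G_def S_def
      by (intro image_subsetI letter_in_free_group)
    show "inv\<^bsub>G\<^esub> s \<in> S" if "s \<in> S" for s
    proof -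
      obtain l where l: "l \<in> letters" "s = [l]" using \<open>s \<in> S\<close> unfolding S_def by blast
      have "letter_inv l \<in> letters" using l(1) by (simp only: letter_inv_in_iff)
      then show ?thesis unfolding G_def S_def l(2) inv_free_group_letter[OF l(1)] by (rule imageI)
    qed
    show "pa_rational_homeo 1 (f s)" for s
      unfolding f_def
      by (rule pa_rational_homeo_line_lift[OF piecewise_affine_rational_letter_map
            piecewise_affine_rational_letter_map letter_map_inverse])
    show "pinv (f s) = f (inv\<^bsub>G\<^esub> s)" if "s \<in> S" for s
    proof -
      obtain l where l: "l \<in> letters" "s = [l]" using \<open>s \<in> S\<close> unfolding S_def by blast
      have "inv\<^bsub>G\<^esub> s = [letter_inv l]"
        unfolding G_def l(2) using l(1) by (rule inv_free_group_letter)
      moreover have "pinv (line_lift (letter_map l)) = line_lift (letter_map (letter_inv l))"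
        using lift_inverse by (rule pinv_eqI)
      ultimately show ?thesis by (simp add: f_def l(2))
    qed
    have "0 \<in> limit_points" unfolding limit_points_def
      by (intro CollectI exI[of _ "[]"]) (auto simp: reduced_Cons)
    then show "line_pt ` limit_points \<noteq> {}" by blast
    show "\<exists>u\<in>line_pt ` limit_points. f s t = Some u"
      if "s \<in> S" "t \<in> line_pt ` limit_points" for s t
    proof -
      obtain l x where lx: "l \<in> letters" "s = [l]" "x \<in> limit_points" "t = line_pt x"
        using \<open>s \<in> S\<close> \<open>t \<in> line_pt ` limit_points\<close> unfolding S_def by blast
      obtain y where "y \<in> limit_points" "letter_map l x = Some y"
        using lx(1,3) by (rule letter_map_limit_points)
      then show ?thesis by (simp add: f_def lx)
    qed
    show "foldr \<beta> \<one>\<^bsub>G\<^esub> t = t" for t by (simp add: G_def free_group_simps)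
    show "foldr \<beta> (v \<otimes>\<^bsub>G\<^esub> w) t = foldr \<beta> v (foldr \<beta> w t)"
      if "v \<in> carrier G" "w \<in> carrier G" "t \<in> T" for v w t
      using that unfolding G_def free_group_simps
      by (intro foldr_cons_cancel_action[where X = "{0, 1}" and T = T and \<beta> = \<beta>, OF \<beta>_inverse \<beta>(2)])
        blast+
    show "f s t = Some (foldr \<beta> s t)" if "s \<in> S" "t \<in> T" for s t
    proof -
      obtain l where l: "l \<in> letters" "s = [l]" using \<open>s \<in> S\<close> unfolding S_def by blast
      then show ?thesis using \<beta>(1)[OF l(1) \<open>t \<in> T\<close>] by (simp add: f_def)
    qed
    show "\<exists>h\<in>carrier G. foldr \<beta> w (foldr \<beta> h t) \<noteq> foldr \<beta> h t"
      if "w \<in> carrier G" "w \<noteq> \<one>\<^bsub>G\<^esub>" "t \<in> T" for w t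
    proof -
      have w: "w \<noteq> []" "set w \<subseteq> letters" "reduced w"
        using that unfolding G_def free_group_simps by blast+
      obtain j where j: "j \<in> letters" "t \<in> line_pt ` cell j" using in_cell \<open>t \<in> T\<close> by blast
      \<comment> \<open>The letter \<open>m\<close> must not cancel against \<open>w\<close> or the address of \<open>t\<close>, and must differ from the
        first letter of \<open>w\<close>, so that \<open>w\<close> takes \<open>cell m\<close> to another cell.\<close>
      have "card {letter_inv (last w), hd w, letter_inv j} < card letters"
        by (simp add: card_insert_if card_cartesian_product card_UNIV_bool)
      then have "\<not> letters \<subseteq> {letter_inv (last w), hd w, letter_inv j}"
        by (metis card_mono finite.emptyI finite.insertI not_le)
      then obtain m where m: "m \<in> letters" "m \<noteq> letter_inv (last w)" "m \<noteq> hd w" "m \<noteq> letter_inv j"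
        by blast
      let ?u = "foldr \<beta> [m] t"
      have "j \<noteq> letter_inv m" using m(4) letter_inv_letter_inv by metis
      then have u: "?u \<in> line_pt ` cell m" using ping[OF j(1) _ j(2), of m] by simp
      have "foldr \<beta> w ?u \<in> line_pt ` cell (hd w)" using w m(1,2) u by (rule pong)
      then have "foldr \<beta> w ?u \<noteq> ?u" using u cells_disjoint m(3) by metis
      moreover have "[m] \<in> carrier G" unfolding G_def using m(1) by (rule letter_in_free_group)
      ultimately show ?thesis by blast
    qed
  qed (auto simp: S_def)
  then show ?thesis by (simp add: G_def)
qed

theorem corollary5p13:
  shows "PA'_recognizable (free_group {0, 1 :: nat}) \<and>
    (\<forall>G :: ('a, 'b) monoid_scheme. group G \<and> finite (carrier G) \<longrightarrow> PA'_recognizable G)"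
  using PA'_recognizable_free_group_2 PA'_recognizable_finite_group by blast

end
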